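(* Let $1\leq r<s$ be integers and let $G$ be the complete bipartite graph $K_{2r,2s}$. Then $\mathrm{av}(G)=2r-1$ and $\overline{\mathrm{av}}(G)=2r-\frac{r}{r+s}$.
   Context: An Eulerian circuit is a closed trail traversing every edge exactly once. For an Eulerian graph with $m$ edges and vertex $x$, two Eulerian circuits $x,v_1,\ldots,v_{m-1},x$ and $x,w_1,\ldots,w_{m-1},x$ are avoiding if for each $1\le i\le m-1$, $v_i\ne w_i$ and $v_i,w_i$ are non-adjacent; a set of Eulerian circuits is mutually avoiding if they are pairwise avoiding. For a vertex $v$ of an Eulerian graph $G$, $\mathrm{av}(v)$ is the maximum number of mutually avoiding Eulerian circuits starting and ending at $v$. The avoidance index is $\mathrm{av}(G)=\min_{v\in V(G)}\mathrm{av}(v)$, and the mean avoidance index is $\overline{\mathrm{av}}(G)=\frac{1}{|V(G)|}\sum_{v\in V(G)}\mathrm{av}(v)$. *)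

theory Defs
  imports Complex_Main
begin

text \<open>A finite simple graph is given by its vertex set \<open>V\<close> and a set \<open>E\<close> of
  two-element subsets of \<open>V\<close>; a walk is given by its list of vertices.\<close>

definition simple_graph :: "'a set \<Rightarrow> 'a set set \<Rightarrow> bool" where
  "simple_graph V E \<longleftrightarrow> finite V \<and> E \<subseteq> {e. e \<subseteq> V \<and> card e = 2}"

definition complete_bipartite :: "nat \<Rightarrow> nat \<Rightarrow> 'a set \<Rightarrow> 'a set set \<Rightarrow> bool" where
  "complete_bipartite m n V E \<longleftrightarrow>
     (\<exists>A B. finite A \<and> finite B \<and> A \<inter> B = {} \<and> card A = m \<and> card B = n \<and>
            V = A \<union> B \<and> E = {{a, b} | a b. a \<in> A \<and> b \<in> B})"

definition adjacent :: "'a set set \<Rightarrow> 'a \<Rightarrow> 'a \<Rightarrow> bool" where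
  "adjacent E u v \<longleftrightarrow> {u, v} \<in> E"

definition walk_edges :: "'a list \<Rightarrow> 'a set list" where
  "walk_edges p = map (\<lambda>(u, v). {u, v}) (zip p (tl p))"

definition trail :: "'a set \<Rightarrow> 'a set set \<Rightarrow> 'a list \<Rightarrow> bool" where
  "trail V E p \<longleftrightarrow> p \<noteq> [] \<and> set p \<subseteq> V \<and> successively (adjacent E) p \<and> distinct (walk_edges p)"

text \<open>The vertex list \<open>x, v\<^sub>1, \<dots>, v\<^sub>m\<^sub>-\<^sub>1, x\<close> of a circuit has \<open>card E + 1\<close> entries,
  and \<open>v\<^sub>i\<close> is its entry at index \<open>i\<close>.\<close>

definition eulerian_circuit :: "'a set \<Rightarrow> 'a set set \<Rightarrow> 'a \<Rightarrow> 'a list \<Rightarrow> bool" where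
  "eulerian_circuit V E x p \<longleftrightarrow>
     trail V E p \<and> hd p = x \<and> last p = x \<and> set (walk_edges p) = E"

definition avoiding :: "'a set set \<Rightarrow> 'a list \<Rightarrow> 'a list \<Rightarrow> bool" where
  "avoiding E p q \<longleftrightarrow>
     (\<forall>i\<in>{1..card E - 1}. p ! i \<noteq> q ! i \<and> \<not> adjacent E (p ! i) (q ! i))"

definition mutually_avoiding :: "'a set \<Rightarrow> 'a set set \<Rightarrow> 'a \<Rightarrow> 'a list set \<Rightarrow> bool" where
  "mutually_avoiding V E x C \<longleftrightarrow>
     (\<forall>p\<in>C. eulerian_circuit V E x p) \<and> pairwise (avoiding E) C"

definition av :: "'a set \<Rightarrow> 'a set set \<Rightarrow> 'a \<Rightarrow> nat" where
  "av V E x = Max {card C | C. mutually_avoiding V E x C}"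

definition av_index :: "'a set \<Rightarrow> 'a set set \<Rightarrow> nat" where
  "av_index V E = Min (av V E ` V)"

definition mean_av_index :: "'a set \<Rightarrow> 'a set set \<Rightarrow> real" where
  "mean_av_index V E = (\<Sum>v\<in>V. real (av V E v)) / real (card V)"

lemma complete_bipartite_simple_graph:
  assumes "complete_bipartite m n V E"
  shows "simple_graph V E"
proof -
  obtain A B where AB: "finite A" "finite B" "A \<inter> B = {}" "V = A \<union> B"
      "E = {{a, b} | a b. a \<in> A \<and> b \<in> B}"
    using assms unfolding complete_bipartite_def by blast
  have "{a, b} \<subseteq> V \<and> card {a, b} = 2" if "a \<in> A" "b \<in> B" for a b
  proof -
    have "a \<noteq> b"
      using that AB(3) by blast
    then show ?thesis
      using that AB(4) by simp
  qed
  then show ?thesis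
    using AB unfolding simple_graph_def by blast
qed

lemma length_eulerian_circuit:
  assumes "eulerian_circuit V E x p"
  shows "length p = card E + 1"
proof -
  have "length (walk_edges p) = card E"
    using assms distinct_card[of "walk_edges p"] by (simp add: eulerian_circuit_def trail_def)
  moreover have "length (walk_edges p) = length p - 1"
    by (simp add: walk_edges_def)
  moreover have "p \<noteq> []"
    using assms by (simp add: eulerian_circuit_def trail_def)
  ultimately show ?thesis
    by (cases p) auto
qed

text \<open>The set in the definition of \<^const>\<open>av\<close> is finite and nonempty, so its maximum
  is a genuine one.\<close>

lemma av_set:
  assumes "simple_graph V E"
  shows "finite {card C | C. mutually_avoiding V E x C}"
    and "{card C | C. mutually_avoiding V E x C} \<noteq> {}"
proof -
  let ?L = "{p. set p \<subseteq> V \<and> length p = card E + 1}"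
  have "finite ?L"
    using assms by (intro finite_lists_length_eq) (simp add: simple_graph_def)
  moreover have "{card C | C. mutually_avoiding V E x C} \<subseteq> card ` Pow ?L"
  proof
    fix k
    assume "k \<in> {card C | C. mutually_avoiding V E x C}"
    then obtain C where C: "k = card C" "mutually_avoiding V E x C"
      by blast
    have "p \<in> ?L" if "p \<in> C" for p
    proof -
      have p: "eulerian_circuit V E x p"
        using that C(2) by (simp add: mutually_avoiding_def)
      then have "set p \<subseteq> V"
        by (simp add: eulerian_circuit_def trail_def)
      with length_eulerian_circuit[OF p] show ?thesis
        by simp
    qed
    then show "k \<in> card ` Pow ?L"
      using C(1) by blast
  qed
  ultimately show "finite {card C | C. mutually_avoiding V E x C}"
    by (meson finite_Pow_iff finite_imageI finite_subset)
  have "mutually_avoiding V E x {}"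
    by (simp add: mutually_avoiding_def)
  then show "{card C | C. mutually_avoiding V E x C} \<noteq> {}"
    by blast
qed

end

theory Submission
  imports Defs
begin

text \<open>
  Let \<open>A\<close> and \<open>B\<close> be the sides of size \<open>2r\<close> and \<open>2s\<close>. Two vertices on the same side are never adjacent,
  so mutually avoiding circuits only have to differ at every interior position. From \<open>x \<in> B\<close> the
  first interior vertex lies in \<open>A\<close>, so \<open>av(x) \<le> 2r\<close>; from \<open>x \<in> A\<close> the second one lies in
  \<open>A - {x}\<close>, because returning at once would repeat an edge, so \<open>av(x) \<le> 2r - 1\<close>.

  For the lower bounds a circuit is read as \<open>s\<close> Hamiltonian cycles through \<open>A\<close> whose edges
  are labelled by \<open>B\<close>. It is Eulerian if and only if the edges carrying a given label form a perfect
  matching of \<open>A\<close>. From \<open>x \<in> A\<close> the cycles of the circuits come from a cyclic Latin square and the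
  labels are cyclic shifts of one labelling. From \<open>x \<in> B\<close> all circuits start with the label \<open>x\<close>,
  and the difficulty is to use the later occurrences of \<open>x\<close> at different times. For this, \<open>r\<close>
  circuits go round \<open>0, 1, \<dots>, 2r - 1\<close> forwards throughout, with \<open>x\<close> at even times, and the other
  \<open>r\<close> circuits go forwards once and then backwards, which moves \<open>x\<close> to odd times.
\<close>

section \<open>Alternating circuits in a complete bipartite graph\<close>

text \<open>The reduction modulo \<open>N\<close> acts only at the last entry, where it closes the
  circuit at \<open>f 0\<close>.\<close>

definition alternating :: "nat \<Rightarrow> (nat \<Rightarrow> 'a) \<Rightarrow> (nat \<Rightarrow> 'a) \<Rightarrow> 'a list" where
  "alternating N f g = map (\<lambda>k. if even k then f (k div 2 mod N) else g (k div 2)) [0..<2 * N + 1]"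

lemma length_alternating [simp]: "length (alternating N f g) = 2 * N + 1"
  by (simp add: alternating_def)

lemma nth_alternating:
  "k \<le> 2 * N \<Longrightarrow> alternating N f g ! k = (if even k then f (k div 2 mod N) else g (k div 2))"
  unfolding alternating_def by (subst nth_map) (simp_all del: upt_Suc)

lemma length_walk_edges [simp]: "length (walk_edges p) = length p - 1"
  by (simp add: walk_edges_def)

lemma nth_walk_edges: "Suc k < length p \<Longrightarrow> walk_edges p ! k = {p ! k, p ! Suc k}"
  by (simp add: walk_edges_def nth_tl)

definition biclique :: "'a set \<Rightarrow> 'a set \<Rightarrow> 'a set set" where
  "biclique A B = {{a, b} | a b. a \<in> A \<and> b \<in> B}"

lemma biclique_commute: "biclique A B = biclique B A"
  unfolding biclique_def by (metis insert_commute)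

lemma adjacent_biclique_iff:
  assumes "A \<inter> B = {}"
  shows "adjacent (biclique A B) u v \<longleftrightarrow> u \<in> A \<and> v \<in> B \<or> u \<in> B \<and> v \<in> A"
  unfolding adjacent_def biclique_def by (auto simp: doubleton_eq_iff)

lemma card_biclique:
  assumes "finite A" "finite B" "A \<inter> B = {}"
  shows "card (biclique A B) = card A * card B"
proof -
  have "biclique A B = (\<lambda>(a, b). {a, b}) ` (A \<times> B)"
    unfolding biclique_def by auto
  moreover have "inj_on (\<lambda>(a, b). {a, b}) (A \<times> B)"
    using assms(3) by (auto simp: inj_on_def doubleton_eq_iff)
  ultimately show ?thesis
    by (simp add: card_image card_cartesian_product)
qed

text \<open>The list has exactly as many edges as the graph, so once every edge is covered none can
  be repeated.\<close>

lemma eulerian_circuit_alternating: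
  assumes fin: "finite A" "finite B" and disj: "A \<inter> B = {}"
    and N: "card A * card B = 2 * N" "0 < N"
    and f: "\<And>t. t < N \<Longrightarrow> f t \<in> A" and g: "\<And>t. t < N \<Longrightarrow> g t \<in> B"
    and cover: "\<And>a b. a \<in> A \<Longrightarrow> b \<in> B \<Longrightarrow> \<exists>t<N. b = g t \<and> (a = f t \<or> a = f (Suc t mod N))"
  shows "eulerian_circuit (A \<union> B) (biclique A B) (f 0) (alternating N f g)"
proof -
  let ?p = "alternating N f g"
  have side: "?p ! k \<in> (if even k then A else B)" if "k \<le> 2 * N" for k
    using that f g N(2) by (auto simp: nth_alternating elim!: oddE)
  have adj: "adjacent (biclique A B) (?p ! k) (?p ! Suc k)" if "k < 2 * N" for k
    using side[of k] side[of "Suc k"] that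
    by (auto simp: adjacent_biclique_iff[OF disj] split: if_splits)
  have sub: "set ?p \<subseteq> A \<union> B"
  proof
    fix v assume "v \<in> set ?p"
    then obtain k where "k \<le> 2 * N" "v = ?p ! k"
      by (auto simp: in_set_conv_nth less_Suc_eq_le)
    then show "v \<in> A \<union> B"
      using side[of k] by (auto split: if_splits)
  qed
  have edge: "{?p ! k, ?p ! Suc k} \<in> set (walk_edges ?p)" if "k < 2 * N" for k
    using that nth_mem[of k "walk_edges ?p"] by (simp add: nth_walk_edges)
  have eq: "set (walk_edges ?p) = biclique A B"
  proof
    show "set (walk_edges ?p) \<subseteq> biclique A B"
      using adj by (auto simp: in_set_conv_nth nth_walk_edges adjacent_def)
    show "biclique A B \<subseteq> set (walk_edges ?p)"
    proof
      fix e assume "e \<in> biclique A B"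
      then obtain a b where e: "e = {a, b}" "a \<in> A" "b \<in> B"
        unfolding biclique_def by blast
      then obtain t where t: "t < N" "b = g t" "a = f t \<or> a = f (Suc t mod N)"
        using cover by blast
      have p: "?p ! (2 * t) = f t" "?p ! Suc (2 * t) = g t" "?p ! Suc (Suc (2 * t)) = f (Suc t mod N)"
        using t(1) by (simp_all add: nth_alternating)
      from t(3) show "e \<in> set (walk_edges ?p)"
      proof
        assume "a = f t"
        then show ?thesis
          using edge[of "2 * t"] t e p by simp
      next
        assume "a = f (Suc t mod N)"
        then show ?thesis
          using edge[of "Suc (2 * t)"] t e p by (simp add: insert_commute)
      qed
    qed
  qed
  have "distinct (walk_edges ?p)"
    using eq N(1) by (intro card_distinct) (simp add: card_biclique fin disj)
  moreover have "successively (adjacent (biclique A B)) ?p"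
    using adj by (simp add: successively_conv_nth)
  moreover have "?p \<noteq> []" "hd ?p = f 0" "last ?p = f 0"
    using N(2) nth_alternating[of 0 N f g] nth_alternating[of "2 * N" N f g]
    by (auto simp: hd_conv_nth last_conv_nth simp flip: length_0_conv)
  ultimately show ?thesis
    using sub eq by (simp add: eulerian_circuit_def trail_def)
qed

text \<open>At each position all circuits stand on the same side, so being distinct there suffices.
  \<open>f_inj\<close> exempts time 0, when all of them stand at \<open>x\<close>.\<close>

lemma mutually_avoiding_alternating:
  assumes fin: "finite A" "finite B" and disj: "A \<inter> B = {}"
    and N: "card A * card B = 2 * N" "0 < N"
    and f: "\<And>i t. i < k \<Longrightarrow> t < N \<Longrightarrow> f i t \<in> A"
    and g: "\<And>i t. i < k \<Longrightarrow> t < N \<Longrightarrow> g i t \<in> B"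
    and start: "\<And>i. i < k \<Longrightarrow> f i 0 = x"
    and cover: "\<And>i a b. i < k \<Longrightarrow> a \<in> A \<Longrightarrow> b \<in> B \<Longrightarrow>
      \<exists>t<N. b = g i t \<and> (a = f i t \<or> a = f i (Suc t mod N))"
    and f_inj: "\<And>t. 0 < t \<Longrightarrow> t < N \<Longrightarrow> inj_on (\<lambda>i. f i t) {..<k}"
    and g_inj: "\<And>t. t < N \<Longrightarrow> inj_on (\<lambda>i. g i t) {..<k}"
  shows "\<exists>C. mutually_avoiding (A \<union> B) (biclique A B) x C \<and> card C = k"
proof -
  let ?p = "\<lambda>i. alternating N (f i) (g i)"
  have neq: "?p i ! n \<noteq> ?p j ! n"
    if "i < k" "j < k" "i \<noteq> j" "1 \<le> n" "n < 2 * N" for i j n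
  proof (cases "even n")
    case True
    then show ?thesis
      using that f_inj[of "n div 2"] by (auto simp: nth_alternating dest: inj_onD elim!: evenE)
  next
    case False
    moreover have "n div 2 < N"
      using that by linarith
    ultimately show ?thesis
      using that inj_onD[OF g_inj[of "n div 2"], of i j] by (auto simp: nth_alternating)
  qed
  have "avoiding (biclique A B) (?p i) (?p j)" if "i < k" "j < k" "i \<noteq> j" for i j
    unfolding avoiding_def
  proof
    fix n assume "n \<in> {1..card (biclique A B) - 1}"
    then have n: "1 \<le> n" "n < 2 * N"
      using N by (auto simp: card_biclique fin disj)
    have "?p i ! n \<in> A \<and> ?p j ! n \<in> A \<or> ?p i ! n \<in> B \<and> ?p j ! n \<in> B"
      using n that f g by (auto simp: nth_alternating)
    then show "?p i ! n \<noteq> ?p j ! n \<and> \<not> adjacent (biclique A B) (?p i ! n) (?p j ! n)"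
      using neq[OF that n] disj by (auto simp: adjacent_biclique_iff[OF disj])
  qed
  then have "pairwise (avoiding (biclique A B)) (?p ` {..<k})"
    by (auto simp: pairwise_def)
  moreover have "eulerian_circuit (A \<union> B) (biclique A B) x (?p i)" if "i < k" for i
    using eulerian_circuit_alternating[OF fin disj N, of "f i" "g i"] that f g start cover by simp
  \<comment> \<open>Position 1 alone tells the circuits apart.\<close>
  moreover have "inj_on ?p {..<k}"
    using neq[of _ _ 1] N(2) by (force simp: inj_on_def)
  ultimately show ?thesis
    by (intro exI[of _ "?p ` {..<k}"]) (auto simp: mutually_avoiding_def card_image)
qed

section \<open>Circuits given by grids\<close>

lemma div_mod_grid:
  fixes c n j :: nat
  assumes "c < n"
  shows "(c + n * j) div n = j" "(c + n * j) mod n = c"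
  using assms by simp_all

text \<open>Inside a row the predecessor is the previous cell. At the start of a row it is the end
  of the row before, or of the last row if \<open>t = 0\<close>, and that cell holds the same
  \<open>w\<close> as the end of the row of \<open>t\<close>.\<close>

lemma grid_predecessor:
  fixes h :: "nat \<Rightarrow> nat \<Rightarrow> 'b"
  assumes t: "t < m * n" and last: "\<And>j. j < m \<Longrightarrow> h j (n - 1) = w"
  obtains u where "u < m * n" "Suc u mod (m * n) = t"
    "h (u div n) (u mod n) = h (t div n) ((t mod n + n - 1) mod n)"
proof -
  have n: "0 < n" "0 < m"
    using t by (auto intro: gr0I)
  have td: "t div n < m"
    using t by (simp add: less_mult_imp_div_less)
  have lt: "t mod n < n" "n - 1 < n"
    using n by simp_all
  consider "t = 0" | "0 < t" "t mod n = 0" | "0 < t" "t mod n \<noteq> 0"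
    by auto
  then show ?thesis
  proof cases
    case 1
    have "m * n - 1 = (n - 1) + n * (m - 1)"
      using n by (cases m; cases n) auto
    then have "(m * n - 1) div n = m - 1" "(m * n - 1) mod n = n - 1"
      using div_mod_grid[OF lt(2)] by metis+
    then show ?thesis
      using that[of "m * n - 1"] 1 n last by simp
  next
    case 2
    then obtain q where q: "t = n * q" "0 < q"
      by (auto simp: mod_eq_0_iff_dvd elim!: dvdE)
    have "t - 1 = (n - 1) + n * (q - 1)"
      using n q by (cases q; cases n) auto
    then have "(t - 1) div n = q - 1" "(t - 1) mod n = n - 1"
      using div_mod_grid[OF lt(2)] by metis+
    moreover have "t - 1 < m * n"
      using t by linarith
    ultimately show ?thesis
      using that[of "t - 1"] 2 n t last[of "q - 1"] last[of q] q td by simp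
  next
    case 3
    have "t - 1 = (t mod n - 1) + n * (t div n)"
      using 3 mod_mult_div_eq[of t n] by linarith
    moreover have lt': "t mod n - 1 < n"
      using lt by linarith
    ultimately have "(t - 1) div n = t div n" "(t - 1) mod n = t mod n - 1"
      using div_mod_grid by metis+
    moreover have "(t mod n + n - 1) mod n = t mod n - 1"
    proof -
      have "t mod n + n - 1 = n + (t mod n - 1)"
        using 3 by linarith
      then show ?thesis
        using lt' by (metis mod_add_self1 mod_less)
    qed
    ultimately show ?thesis
      using that[of "t - 1"] 3 n t by simp
  qed
qed

text \<open>
  Circuit \<open>i\<close> is a family of \<open>m\<close> closed walks (rows) of length \<open>n\<close>, performed one after the other. The
  label \<open>lab i j c\<close> is the vertex of the other side visited immediately before \<open>vtx i j c\<close>. As all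
  rows end in the same vertex \<open>w i\<close>, the predecessor of a cell may be taken cyclically inside its row.
\<close>

locale cyclic_grid =
  fixes m n k :: nat
    and vtx lab :: "nat \<Rightarrow> nat \<Rightarrow> nat \<Rightarrow> nat"
    and w :: "nat \<Rightarrow> nat"
  assumes m_pos: "0 < m" and n_pos: "0 < n"
    and vtx_less: "\<And>i j c. i < k \<Longrightarrow> j < m \<Longrightarrow> c < n \<Longrightarrow> vtx i j c < n"
    and lab_less: "\<And>i j c. i < k \<Longrightarrow> j < m \<Longrightarrow> c < n \<Longrightarrow> lab i j c < 2 * m"
    and vtx_last: "\<And>i j. i < k \<Longrightarrow> j < m \<Longrightarrow> vtx i j (n - 1) = w i"
    and cover: "\<And>i a b. i < k \<Longrightarrow> a < n \<Longrightarrow> b < 2 * m \<Longrightarrow>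
      \<exists>j<m. \<exists>c<n. b = lab i j c \<and> (a = vtx i j c \<or> a = vtx i j ((c + n - 1) mod n))"
begin

text \<open>A label is passed between times \<open>t\<close> and \<open>Suc t\<close>, where
  \<open>Suc t\<close>, modulo \<open>m * n\<close>, is the time of its cell.\<close>

lemma cover_time:
  assumes "i < k" "a < n" "b < 2 * m"
  obtains t where "t < m * n" "b = lab i (Suc t mod (m * n) div n) (Suc t mod (m * n) mod n)"
    "a = vtx i (Suc t mod (m * n) div n) (Suc t mod (m * n) mod n) \<or> a = vtx i (t div n) (t mod n)"
proof -
  obtain j c where jc: "j < m" "c < n" "b = lab i j c"
      "a = vtx i j c \<or> a = vtx i j ((c + n - 1) mod n)"
    using cover assms by blast
  have "c + n * j < n * Suc j"
    using jc by simp
  also have "\<dots> \<le> m * n"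
    using jc by (metis Suc_leI mult.commute mult_le_mono1)
  finally have "c + n * j < m * n" .
  moreover note div_mod_grid[OF jc(2), of j]
  ultimately show ?thesis
    using grid_predecessor[of "c + n * j" m n "vtx i" "w i"] vtx_last assms(1) jc that by metis
qed

lemma time_cell:
  assumes "t < m * n"
  shows "t div n < m" "t mod n < n" "0 < t \<Longrightarrow> (t div n, t mod n) \<noteq> (0, 0)"
  using assms n_pos by (auto simp: less_mult_imp_div_less div_eq_0_iff)

lemma mutually_avoiding_from_vertex:
  assumes bij: "bij_betw \<phi> {..<n} A" "bij_betw \<psi> {..<2 * m} B" and disj: "A \<inter> B = {}"
    and start: "\<And>i. i < k \<Longrightarrow> vtx i 0 0 = 0"
    and vtx_inj: "\<And>j c. j < m \<Longrightarrow> c < n \<Longrightarrow> (j, c) \<noteq> (0, 0) \<Longrightarrow> inj_on (\<lambda>i. vtx i j c) {..<k}"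
    and lab_inj: "\<And>j c. j < m \<Longrightarrow> c < n \<Longrightarrow> inj_on (\<lambda>i. lab i j c) {..<k}"
  shows "\<exists>C. mutually_avoiding (A \<union> B) (biclique A B) (\<phi> 0) C \<and> card C = k"
proof -
  let ?s = "\<lambda>t. Suc t mod (m * n)"
  let ?f = "\<lambda>i t. \<phi> (vtx i (t div n) (t mod n))"
  \<comment> \<open>The vertex at time \<open>t\<close> is followed by the label of the next cell,
    hence the shift by \<open>?s\<close>.\<close>
  let ?g = "\<lambda>i t. \<psi> (lab i (?s t div n) (?s t mod n))"
  have s: "?s t < m * n" for t
    using m_pos n_pos by simp
  show ?thesis
  proof (rule mutually_avoiding_alternating[of A B "m * n" k ?f ?g])
    show "finite A" "finite B"
      using bij by (auto dest: bij_betw_finite)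
    show "card A * card B = 2 * (m * n)"
      using bij by (simp add: bij_betw_same_card[symmetric])
    show "0 < m * n"
      using m_pos n_pos by simp
    show "?f i t \<in> A" if "i < k" "t < m * n" for i t
      using bij_betwE[OF bij(1)] vtx_less time_cell that by simp
    show "?g i t \<in> B" if "i < k" "t < m * n" for i t
      using bij_betwE[OF bij(2)] lab_less time_cell[OF s] that by simp
    show "\<exists>t<m * n. b = ?g i t \<and> (a = ?f i t \<or> a = ?f i (?s t))"
      if i: "i < k" and "a \<in> A" "b \<in> B" for i a b
    proof -
      have "a \<in> \<phi> ` {..<n}" "b \<in> \<psi> ` {..<2 * m}"
        using that bij by (simp_all add: bij_betw_imp_surj_on)
      then obtain a' b' where ab: "a' < n" "a = \<phi> a'" "b' < 2 * m" "b = \<psi> b'"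
        by blast
      obtain t where "t < m * n" "b' = lab i (?s t div n) (?s t mod n)"
        "a' = vtx i (?s t div n) (?s t mod n) \<or> a' = vtx i (t div n) (t mod n)"
        by (rule cover_time[OF i ab(1,3)])
      then show ?thesis
        using ab by blast
    qed
    show "inj_on (\<lambda>i. ?f i t) {..<k}" if "0 < t" "t < m * n" for t
    proof -
      have "inj_on \<phi> ((\<lambda>i. vtx i (t div n) (t mod n)) ` {..<k})"
        by (rule inj_on_subset[OF bij_betw_imp_inj_on[OF bij(1)]])
          (use vtx_less time_cell that in auto)
      then show ?thesis
        using comp_inj_on[OF vtx_inj[OF time_cell(1,2)[OF that(2)] time_cell(3)[OF that(2,1)]]] by (simp add: comp_def)
    qed
    show "inj_on (\<lambda>i. ?g i t) {..<k}" for t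
    proof -
      have "inj_on \<psi> ((\<lambda>i. lab i (?s t div n) (?s t mod n)) ` {..<k})"
        by (rule inj_on_subset[OF bij_betw_imp_inj_on[OF bij(2)]])
          (use lab_less time_cell[OF s] in auto)
      then show ?thesis
        using comp_inj_on[OF lab_inj[OF time_cell(1,2)[OF s]]] by (simp add: comp_def)
    qed
  qed (use disj start in simp_all)
qed

lemma mutually_avoiding_from_label:
  assumes bij: "bij_betw \<phi> {..<n} A" "bij_betw \<psi> {..<2 * m} B" and disj: "A \<inter> B = {}"
    and start: "\<And>i. i < k \<Longrightarrow> lab i 0 0 = 0"
    and vtx_inj: "\<And>j c. j < m \<Longrightarrow> c < n \<Longrightarrow> inj_on (\<lambda>i. vtx i j c) {..<k}"
    and lab_inj: "\<And>j c. j < m \<Longrightarrow> c < n \<Longrightarrow> (j, c) \<noteq> (0, 0) \<Longrightarrow> inj_on (\<lambda>i. lab i j c) {..<k}"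
  shows "\<exists>C. mutually_avoiding (B \<union> A) (biclique B A) (\<psi> 0) C \<and> card C = k"
proof -
  let ?s = "\<lambda>t. Suc t mod (m * n)"
  \<comment> \<open>No shift here: in a circuit started at a label, each cell contributes its label
    and then its vertex.\<close>
  let ?g = "\<lambda>i t. \<phi> (vtx i (t div n) (t mod n))"
  let ?f = "\<lambda>i t. \<psi> (lab i (t div n) (t mod n))"
  show ?thesis
  proof (rule mutually_avoiding_alternating[of B A "m * n" k ?f ?g])
    show "finite A" "finite B"
      using bij by (auto dest: bij_betw_finite)
    show "card B * card A = 2 * (m * n)"
      using bij by (simp add: bij_betw_same_card[symmetric])
    show "0 < m * n"
      using m_pos n_pos by simp
    show "?g i t \<in> A" if "i < k" "t < m * n" for i t
      using bij_betwE[OF bij(1)] vtx_less time_cell that by simp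
    show "?f i t \<in> B" if "i < k" "t < m * n" for i t
      using bij_betwE[OF bij(2)] lab_less time_cell that by simp
    show "\<exists>t<m * n. a = ?g i t \<and> (b = ?f i t \<or> b = ?f i (?s t))"
      if i: "i < k" and "b \<in> B" "a \<in> A" for i b a
    proof -
      have "a \<in> \<phi> ` {..<n}" "b \<in> \<psi> ` {..<2 * m}"
        using that bij by (simp_all add: bij_betw_imp_surj_on)
      then obtain a' b' where ab: "a' < n" "a = \<phi> a'" "b' < 2 * m" "b = \<psi> b'"
        by blast
      obtain t where "t < m * n" "b' = lab i (?s t div n) (?s t mod n)"
        "a' = vtx i (?s t div n) (?s t mod n) \<or> a' = vtx i (t div n) (t mod n)"
        by (rule cover_time[OF i ab(1,3)])
      \<comment> \<open>The required time is \<open>t\<close> if the vertex precedes the label and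
        \<open>?s t\<close> if it follows it.\<close>
      moreover have "?s t < m * n"
        using m_pos n_pos by simp
      ultimately show ?thesis
        using ab by blast
    qed
    show "inj_on (\<lambda>i. ?f i t) {..<k}" if "0 < t" "t < m * n" for t
    proof -
      have "inj_on \<psi> ((\<lambda>i. lab i (t div n) (t mod n)) ` {..<k})"
        by (rule inj_on_subset[OF bij_betw_imp_inj_on[OF bij(2)]])
          (use lab_less time_cell that in auto)
      then show ?thesis
        using comp_inj_on[OF lab_inj[OF time_cell(1,2)[OF that(2)] time_cell(3)[OF that(2,1)]]] by (simp add: comp_def)
    qed
    show "inj_on (\<lambda>i. ?g i t) {..<k}" if "t < m * n" for t
    proof -
      have "inj_on \<phi> ((\<lambda>i. vtx i (t div n) (t mod n)) ` {..<k})"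
        by (rule inj_on_subset[OF bij_betw_imp_inj_on[OF bij(1)]])
          (use vtx_less time_cell that in auto)
      then show ?thesis
        using comp_inj_on[OF vtx_inj[OF time_cell(1,2)[OF that]]] by (simp add: comp_def)
    qed
  qed (use disj start in auto)
qed

end

section \<open>Circuits from the smaller side\<close>

lemma mod_add_left_cancel:
  fixes a b u n :: nat
  assumes "(u + a) mod n = (u + b) mod n" "a < n" "b < n"
  shows "a = b"
proof -
  have "x = y" if "x \<le> y" "(u + y) mod n = (u + x) mod n" "y < n" for x y :: nat
  proof -
    have "n dvd u + y - (u + x)"
      using that mod_eq_dvd_iff_nat[of "u + x" "u + y" n] by simp
    then show ?thesis
      using that by (auto dest: dvd_imp_le)
  qed
  then show ?thesis
    using assms by (metis nat_le_linear)
qed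

lemma mod_add_surj:
  fixes a u n :: nat
  assumes "a < n"
  obtains c where "c < n" "(u + c) mod n = a"
proof
  \<comment> \<open>The summand \<open>n\<close> keeps the subtraction from truncating.\<close>
  let ?c = "(a + n - u mod n) mod n"
  show "?c < n"
    using assms by simp
  have "(u + ?c) mod n = (u mod n + (a + n - u mod n)) mod n"
    by (simp add: mod_simps)
  also have "u mod n + (a + n - u mod n) = a + n"
    using assms by (simp add: trans_le_add2)
  finally show "(u + ?c) mod n = a"
    using assms by simp
qed

lemma mod_Suc_pred:
  fixes c n :: nat
  assumes "c < n"
  shows "(Suc c mod n + n - 1) mod n = c"
  using assms by (cases "Suc c = n") auto

text \<open>For even \<open>n\<close> the parity of columns alternates also across the end of a row,
  so of a column and its cyclic successor exactly one has a prescribed parity.\<close>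

lemma even_mod_Suc:
  fixes c n :: nat
  assumes "even n"
  shows "even (Suc c mod n) \<longleftrightarrow> odd c"
  using assms by (simp add: dvd_mod_iff)

text \<open>
  After column 0 of row 0, which is the start, row 0 of the circuits \<open>i < n - 1\<close> is a Latin square of
  order \<open>n - 1\<close> on the nonzero vertices.
\<close>

definition small_vtx :: "nat \<Rightarrow> nat \<Rightarrow> nat \<Rightarrow> nat \<Rightarrow> nat" where
  "small_vtx n i j c =
    (if j = 0 then if c = 0 then 0 else 1 + (i + c) mod (n - 1) else (i + 2 + c) mod n)"

text \<open>Up to the shift by \<open>i\<close>, the labels \<open>2 * j\<close> and
  \<open>2 * j + 1\<close> alternate along the even cycle of row \<open>j\<close>, so each of them
  carries a perfect matching.\<close>

definition small_lab :: "nat \<Rightarrow> nat \<Rightarrow> nat \<Rightarrow> nat \<Rightarrow> nat" where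
  "small_lab m i j c = (2 * j + of_bool (even c) + i) mod (2 * m)"

lemma small_vtx_surj:
  assumes "a < n" "2 \<le> n"
  obtains c where "c < n" "small_vtx n i j c = a"
proof (cases "j = 0")
  case False
  then show ?thesis
    using mod_add_surj[OF assms(1), of "i + 2"] that by (auto simp: small_vtx_def)
next
  case True
  show ?thesis
  proof (cases "a = 0")
    case True
    then show ?thesis
      using that[of 0] \<open>j = 0\<close> assms by (simp add: small_vtx_def)
  next
    case False
    then have "a - 1 < n - 1"
      using assms by simp
    then obtain c where c: "c < n - 1" "(i + c) mod (n - 1) = a - 1"
      by (rule mod_add_surj)
    show ?thesis
    proof (cases "c = 0")
      case True
      \<comment> \<open>Column 0 of row 0 holds the start, so the residue 0 is realised by column
        \<open>n - 1\<close>.\<close>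
      then have "(i + (n - 1)) mod (n - 1) = a - 1"
        using c(2) by (simp only: mod_add_self2 add_0_right)
      moreover have "small_vtx n i j (n - 1) = 1 + (i + (n - 1)) mod (n - 1)"
        using \<open>j = 0\<close> assms by (simp add: small_vtx_def)
      ultimately show ?thesis
        using that[of "n - 1"] False assms by simp
    next
      case c0: False
      then show ?thesis
        using that[of c] c False \<open>j = 0\<close> by (simp add: small_vtx_def)
    qed
  qed
qed

lemma cyclic_grid_small:
  assumes "0 < m" "even n" "2 \<le> n"
  shows "cyclic_grid m n (n - 1) (small_vtx n) (small_lab m) Suc"
proof
  fix i j c assume "i < n - 1" "j < m" "c < n"
  have "(i + c) mod (n - 1) < n - 1"
    using assms by simp
  then have "1 + (i + c) mod (n - 1) < n"
    by linarith
  then show "small_vtx n i j c < n"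
    using assms by (auto simp: small_vtx_def)
  show "small_lab m i j c < 2 * m"
    using assms by (simp add: small_lab_def)
next
  fix i j assume i: "i < n - 1" "j < m"
  \<comment> \<open>The offset 2 makes the later rows end in \<open>Suc i\<close>, where row 0
    ends.\<close>
  have "i + 2 + (n - 1) = Suc i + n"
    using assms by simp
  then have "(i + 2 + (n - 1)) mod n = Suc i"
    using i by (metis less_diff_conv mod_add_self2 mod_less add.commute plus_1_eq_Suc)
  moreover have "(i + (n - 1)) mod (n - 1) = i"
    using i by (simp only: mod_add_self2 mod_less)
  ultimately show "small_vtx n i j (n - 1) = Suc i"
    using assms by (simp add: small_vtx_def)
next
  fix i a b assume i: "i < n - 1" and a: "a < n" and b: "b < 2 * m"
  \<comment> \<open>\<open>d\<close> is the label before the shift by \<open>i\<close>: half of it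
    is the row, and its parity selects the columns, odd labels being on even columns.\<close>
  obtain d where d: "d < 2 * m" "(i + d) mod (2 * m) = b"
    using b by (rule mod_add_surj)
  define j where "j = d div 2"
  have j: "j < m"
    using d by (simp add: j_def less_mult_imp_div_less mult.commute)
  have d2: "d = 2 * j + of_bool (odd d)"
    by (simp add: j_def)
  have lab: "b = small_lab m i j c" if "even c \<longleftrightarrow> odd d" for c
    using d(2) d2 that by (simp add: small_lab_def add.commute)
  obtain c where c: "c < n" "small_vtx n i j c = a"
    using a assms(3) by (rule small_vtx_surj)
  show "\<exists>j<m. \<exists>c<n. b = small_lab m i j c \<and> (a = small_vtx n i j c \<or> a = small_vtx n i j ((c + n - 1) mod n))"
  proof (cases "even c \<longleftrightarrow> odd d")
    case True
    then show ?thesis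
      using j c lab by blast
  next
    case False
    \<comment> \<open>The next column has the right parity, and there \<open>a\<close> is the
      predecessor.\<close>
    then have "even (Suc c mod n) \<longleftrightarrow> odd d"
      using even_mod_Suc[OF assms(2)] by simp
    moreover have "Suc c mod n < n"
      using c by simp
    ultimately show ?thesis
      using j c lab mod_Suc_pred by metis
  qed
qed (use assms in auto)

lemma ex_bij_betw_lessThan:
  assumes "finite A" "x \<in> A"
  shows "\<exists>\<phi>. bij_betw \<phi> {..<card A} A \<and> \<phi> (0 :: nat) = x"
proof -
  have pos: "0 < card A"
    using assms by (auto simp: card_gt_0_iff)
  then have "card ({..<card A} - {0}) = card (A - {x})"
    using assms by simp
  then obtain h where h: "bij_betw h ({..<card A} - {0}) (A - {x})"
    using finite_same_card_bij[of "{..<card A} - {0}" "A - {x}"] assms by auto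
  have "bij_betw (h(0 := x)) (({..<card A} - {0}) \<union> {0}) ((A - {x}) \<union> {(h(0 := x)) 0})"
  proof (rule notIn_Un_bij_betw)
    show "bij_betw (h(0 := x)) ({..<card A} - {0}) (A - {x})"
      using h by (subst bij_betw_cong[of _ _ h]) auto
  qed auto
  moreover have "({..<card A} - {0}) \<union> {0} = {..<card A}" "(A - {x}) \<union> {(h(0 := x)) 0} = A"
    using pos assms by auto
  ultimately show ?thesis
    by (intro exI[of _ "h(0 := x)"]) simp
qed

lemma inj_on_shift_mod:
  fixes n u :: nat
  assumes "\<And>i. i < k \<Longrightarrow> h i < n" "inj_on h {..<k}"
  shows "inj_on (\<lambda>i. (u + h i) mod n) {..<k}"
proof (rule inj_onI)
  fix i j assume "i \<in> {..<k}" "j \<in> {..<k}" "(u + h i) mod n = (u + h j) mod n"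
  then show "i = j"
    using mod_add_left_cancel[of u "h i" n "h j"] assms by (simp add: inj_on_eq_iff)
qed

lemma inj_on_mod_add:
  fixes u n k :: nat
  assumes "k \<le> n"
  shows "inj_on (\<lambda>i. (u + i) mod n) {..<k}"
  using assms by (intro inj_on_shift_mod) auto

text \<open>At a fixed cell the circuits differ by the shift \<open>i < n - 1\<close>, which is
  injective modulo \<open>n - 1\<close> and \<open>n\<close> for vertices and, by
  \<open>n \<le> 2 * m\<close>, modulo \<open>2 * m\<close> for labels.\<close>

lemma exists_mutually_avoiding_small_side:
  assumes fin: "finite A" "finite B" and disj: "A \<inter> B = {}" and card: "card A = n" "card B = 2 * m"
    and n: "even n" "2 \<le> n" "n \<le> 2 * m" and x: "x \<in> A"
  shows "\<exists>C. mutually_avoiding (A \<union> B) (biclique A B) x C \<and> card C = n - 1"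
proof -
  have m: "0 < m"
    using n by simp
  obtain \<phi> where \<phi>: "bij_betw \<phi> {..<n} A" "\<phi> 0 = x"
    using ex_bij_betw_lessThan[OF fin(1) x] unfolding card by blast
  obtain \<psi> where \<psi>: "bij_betw \<psi> {..<2 * m} B"
    using ex_bij_betw_nat_finite[OF fin(2)] unfolding card atLeast0LessThan by blast
  interpret cyclic_grid m n "n - 1" "small_vtx n" "small_lab m" Suc
    using m n(1,2) by (rule cyclic_grid_small)
  have "inj_on (\<lambda>i. small_vtx n i j c) {..<n - 1}" if "(j, c) \<noteq> (0, 0)" for j c
  proof (cases "j = 0")
    case True
    moreover have "inj_on (\<lambda>i. 1 + (c + i) mod (n - 1)) {..<n - 1}"
      using comp_inj_on[OF inj_on_mod_add[of "n - 1" "n - 1" c] inj_on_add[of 1]] by (simp add: comp_def)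
    moreover have "small_vtx n i j c = 1 + (c + i) mod (n - 1)" for i
      using that True by (simp add: small_vtx_def add.commute)
    ultimately show ?thesis
      by presburger
  next
    case False
    then have "small_vtx n i j c = (c + 2 + i) mod n" for i
      by (simp add: small_vtx_def add_ac)
    then show ?thesis
      using inj_on_mod_add[of "n - 1" n "c + 2"] by (simp only: diff_le_self)
  qed
  moreover have "inj_on (\<lambda>i. small_lab m i j c) {..<n - 1}" for j c
    unfolding small_lab_def using n by (intro inj_on_mod_add) simp
  moreover have "small_vtx n i 0 0 = 0" for i
    by (simp add: small_vtx_def)
  ultimately show ?thesis
    using mutually_avoiding_from_vertex[OF \<phi>(1) \<psi> disj] \<phi>(2) by simp
qed

section \<open>Circuits from the larger side\<close>

text \<open>The offset is even so that a vertex has the parity of its column.\<close>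

definition fwd_vtx :: "nat \<Rightarrow> nat \<Rightarrow> nat \<Rightarrow> nat \<Rightarrow> nat" where
  "fwd_vtx r i j c = (c + 2 * i) mod (2 * r)"

text \<open>Even columns carry the labels below \<open>s\<close>, odd ones the rest. The start pins
  label 0 to row 0 of column 0, so the other rows of that column shift the nonzero labels cyclically
  modulo \<open>s - 1\<close>.\<close>

definition fwd_lab :: "nat \<Rightarrow> nat \<Rightarrow> nat \<Rightarrow> nat \<Rightarrow> nat" where
  "fwd_lab s i j c =
    (if odd c then s + (j + i) mod s
     else if c \<noteq> 0 then (j + i) mod s
     else if j = 0 then 0
     else 1 + (j - 1 + i) mod (s - 1))"

text \<open>
  The gap \<open>g\<close> is the edge from \<open>g - 1\<close> to \<open>g\<close> of the cycle through \<open>A\<close>, relative to the offset \<open>2i + 1\<close>. It is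
  crossed in column \<open>g\<close> of the forward row 0 and in column \<open>2r - 1 - g\<close> of the backward rows.
  In every row \<open>j\<close> the plain labels would be \<open>(j + i + 1) mod s\<close> on even gaps and \<open>s + (j + s - 2 - i) mod s\<close>
  on odd ones. In row 0 both families of circuits run forwards and would compete for the same \<open>s\<close>
  labels, so the two labels \<open>i + 1\<close> and \<open>s + (s - 2 - i)\<close> of row 0 are exchanged. Gap 0 has to carry \<open>x = 0\<close>
  in row 0; its exchanged label moves to the row in which the plain label is 0.
\<close>

definition bwd_vtx :: "nat \<Rightarrow> nat \<Rightarrow> nat \<Rightarrow> nat \<Rightarrow> nat" where
  "bwd_vtx r i j c =
    (if j = 0 then (c + (2 * i + 1)) mod (2 * r) else (2 * r - 1 - c + (2 * r + 2 * i)) mod (2 * r))"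

definition bwd_gap :: "nat \<Rightarrow> nat \<Rightarrow> nat \<Rightarrow> nat \<Rightarrow> nat" where
  "bwd_gap s i j g =
    (if j = 0 then if g = 0 then 0 else if even g then s + (s - 2 - i) else i + 1
     else if odd g then s + (j + (s - 2 - i)) mod s
     else if g = 0 \<and> (j + (i + 1)) mod s = 0 then s + (s - 2 - i)
     else (j + (i + 1)) mod s)"

definition bwd_lab :: "nat \<Rightarrow> nat \<Rightarrow> nat \<Rightarrow> nat \<Rightarrow> nat \<Rightarrow> nat" where
  "bwd_lab r s i j c = bwd_gap s i j (if j = 0 then c else 2 * r - 1 - c)"

lemma mod_add_surj_right:
  fixes a u n :: nat
  assumes "a < n"
  obtains c where "c < n" "(c + u) mod n = a"
  using mod_add_surj[OF assms, of u] by (metis add.commute)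

text \<open>Every label occurs in all columns of one parity. The two edges of the cycle at
  \<open>a\<close> lie in cyclically adjacent columns, so one of them has that parity.\<close>

lemma cover_fwd:
  assumes r: "0 < r" and s: "2 \<le> s" and a: "a < 2 * r" and b: "b < 2 * s"
  shows "\<exists>j<s. \<exists>c<2 * r. b = fwd_lab s i j c \<and>
    (a = fwd_vtx r i j c \<or> a = fwd_vtx r i j ((c + 2 * r - 1) mod (2 * r)))"
proof -
  have row: "\<exists>j<s. b = fwd_lab s i j c" if "even c \<longleftrightarrow> b < s" for c
  proof (cases "b < s")
    case False
    then have "b - s < s"
      using b by simp
    then obtain j where "j < s" "(j + i) mod s = b - s"
      by (rule mod_add_surj_right)
    then show ?thesis
      using False that by (intro exI[of _ j]) (simp add: fwd_lab_def)
  next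
    case b_less: True
    consider "c \<noteq> 0" | "c = 0" "b = 0" | "c = 0" "b \<noteq> 0"
      by blast
    then show ?thesis
    proof cases
      case 1
      obtain j where "j < s" "(j + i) mod s = b"
        using b_less by (rule mod_add_surj_right)
      then show ?thesis
        using 1 b_less that by (intro exI[of _ j]) (simp add: fwd_lab_def)
    next
      case 2
      then show ?thesis
        using s by (intro exI[of _ 0]) (simp add: fwd_lab_def)
    next
      case 3
      then have "b - 1 < s - 1"
        using b_less by simp
      then obtain j where "j < s - 1" "(j + i) mod (s - 1) = b - 1"
        by (rule mod_add_surj_right)
      then show ?thesis
        using 3 by (intro exI[of _ "Suc j"]) (simp add: fwd_lab_def)
    qed
  qed
  obtain c where c: "c < 2 * r" "(c + 2 * i) mod (2 * r) = a"
    using a by (rule mod_add_surj_right)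
  show ?thesis
  proof (cases "even c \<longleftrightarrow> b < s")
    case True
    then show ?thesis
      using row c unfolding fwd_vtx_def by metis
  next
    case False
    then have "even (Suc c mod (2 * r)) \<longleftrightarrow> b < s"
      using even_mod_Suc[of "2 * r" c] by simp
    moreover have "Suc c mod (2 * r) < 2 * r"
      using r by simp
    ultimately show ?thesis
      using row c mod_Suc_pred[OF c(1)] unfolding fwd_vtx_def by metis
  qed
qed

text \<open>Again each label occurs on all gaps of one parity \<open>e\<close>, and one of the two
  gaps at \<open>a\<close> has this parity. Whether it is crossed forwards or backwards depends on
  the row found.\<close>

lemma cover_bwd:
  assumes r: "0 < r" and i: "i < r" and s: "r < s" and a: "a < 2 * r" and b: "b < 2 * s"
  shows "\<exists>j<s. \<exists>c<2 * r. b = bwd_lab r s i j c \<and>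
    (a = bwd_vtx r i j c \<or> a = bwd_vtx r i j ((c + 2 * r - 1) mod (2 * r)))"
proof -
  have row: "\<exists>e. \<forall>g. (even g \<longleftrightarrow> e) \<longrightarrow> (\<exists>j<s. b = bwd_gap s i j g)"
  proof -
    \<comment> \<open>The second and third cases are the exchanged labels; the outer cases are plain
      ones.\<close>
    consider "b < s" "b \<noteq> i + 1" | "b = i + 1" | "b = s + (s - 2 - i)" | "s \<le> b" "b \<noteq> s + (s - 2 - i)"
      by linarith
    then show ?thesis
    proof cases
      case 1
      obtain j where j: "j < s" "(j + (i + 1)) mod s = b"
        using 1(1) by (rule mod_add_surj_right)
      have "j \<noteq> 0"
        using j 1 i s by (intro notI) simp
      \<comment> \<open>Only label 0 on gap 0 is left out; row 0 supplies it.\<close>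
      then have "b = bwd_gap s i j g" if "even g" "g \<noteq> 0 \<or> b \<noteq> 0" for g
        using j that by (auto simp: bwd_gap_def)
      moreover have "bwd_gap s i 0 0 = 0"
        by (simp add: bwd_gap_def)
      moreover have "0 < s"
        using j by simp
      ultimately show ?thesis
        using j by metis
    next
      case 2
      then have "b = bwd_gap s i 0 g" if "odd g" for g
        using that by (auto simp: bwd_gap_def odd_pos)
      moreover have "0 < s"
        using s by simp
      ultimately show ?thesis
        by metis
    next
      case 3
      have "0 < s"
        using s by simp
      then obtain j where j: "j < s" "(j + (i + 1)) mod s = 0"
        by (rule mod_add_surj_right)
      have "j \<noteq> 0"
        using j i s by (intro notI) simp
      then have "b = bwd_gap s i j 0"
        using j 3 by (simp add: bwd_gap_def)
      moreover have "b = bwd_gap s i 0 g" if "even g" "g \<noteq> 0" for g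
        using that 3 by (auto simp: bwd_gap_def)
      ultimately show ?thesis
        using j \<open>0 < s\<close> by metis
    next
      case 4
      have "b - s < s"
        using b 4 by simp
      then obtain j where j: "j < s" "(j + (s - 2 - i)) mod s = b - s"
        by (rule mod_add_surj_right)
      have "j \<noteq> 0"
        using j 4 s by (intro notI) simp
      then have "b = bwd_gap s i j g" if "odd g" for g
        using j that 4 by (auto simp: bwd_gap_def)
      then show ?thesis
        using j by metis
    qed
  qed
  then obtain e where e: "\<And>g. (even g \<longleftrightarrow> e) \<Longrightarrow> \<exists>j<s. b = bwd_gap s i j g"
    by blast
  obtain v where v: "v < 2 * r" "(v + (2 * i + 1)) mod (2 * r) = a"
    using a by (rule mod_add_surj_right)
  \<comment> \<open>A backward row reaches position \<open>v\<close> by crossing gap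
    \<open>Suc v\<close>.\<close>
  have vtx_back: "bwd_vtx r i j c = a" if "j \<noteq> 0" "c < 2 * r" "2 * r - 1 - c = Suc v mod (2 * r)" for j c
  proof -
    have "2 * r - 1 - c + (2 * r + 2 * i) = Suc v mod (2 * r) + (2 * r + 2 * i)"
      using that by simp
    then have "bwd_vtx r i j c = (Suc v mod (2 * r) + (2 * r + 2 * i)) mod (2 * r)"
      using that by (simp add: bwd_vtx_def)
    also have "\<dots> = (Suc v + (2 * r + 2 * i)) mod (2 * r)"
      by (rule mod_add_left_eq)
    also have "Suc v + (2 * r + 2 * i) = v + (2 * i + 1) + 2 * r"
      by simp
    finally show ?thesis
      using v(2) by (simp only: mod_add_self2)
  qed
  have vtx_front: "bwd_vtx r i 0 v = a"
    using v by (simp add: bwd_vtx_def)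
  have c_refl: "2 * r - 1 - (2 * r - 1 - g) = g" "2 * r - 1 - g < 2 * r" if "g < 2 * r" for g
    using that by auto
  \<comment> \<open>Position \<open>v\<close> lies between the gaps \<open>v\<close> and
    \<open>Suc v\<close>; \<open>g\<close> is the one of parity \<open>e\<close>.\<close>
  define g where "g = (if even v \<longleftrightarrow> e then v else Suc v mod (2 * r))"
  have g: "g < 2 * r" "even g \<longleftrightarrow> e"
    using v(1) even_mod_Suc[of "2 * r" v] by (auto simp: g_def)
  obtain j where j: "j < s" "b = bwd_gap s i j g"
    using e g by blast
  show ?thesis
  proof (cases "j = 0")
    case True
    then have "b = bwd_lab r s i 0 g"
      using j by (simp add: bwd_lab_def)
    moreover have "a = bwd_vtx r i 0 g \<or> a = bwd_vtx r i 0 ((g + 2 * r - 1) mod (2 * r))"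
      using vtx_front mod_Suc_pred[OF v(1)] by (auto simp: g_def)
    ultimately show ?thesis
      using g j True by blast
  next
    case False
    define c where "c = 2 * r - 1 - g"
    have c: "c < 2 * r" "2 * r - 1 - c = g"
      using c_refl[OF g(1)] by (simp_all add: c_def)
    have "b = bwd_lab r s i j c"
      using j False c by (simp add: bwd_lab_def)
    moreover have "a = bwd_vtx r i j c \<or> a = bwd_vtx r i j ((c + 2 * r - 1) mod (2 * r))"
    proof (cases "even v \<longleftrightarrow> e")
      case True
      then have "g = v"
        by (simp add: g_def)
      \<comment> \<open>Backwards, gap \<open>v\<close> is left from position \<open>v\<close>, so
        \<open>a\<close> sits in the preceding column, that of gap \<open>Suc v\<close>. For
        \<open>c = 0\<close> this is gap 0 in the last column.\<close>
      have "2 * r - 1 - (c + 2 * r - 1) mod (2 * r) = Suc v mod (2 * r)"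
      proof (cases "c = 0")
        case True
        then have "Suc v = 2 * r"
          using c \<open>g = v\<close> r by linarith
        then show ?thesis
          using True by simp
      next
        case False
        then have "c + 2 * r - 1 = 2 * r + (c - 1)"
          by simp
        then have "(c + 2 * r - 1) mod (2 * r) = c - 1"
          using c by (metis less_imp_diff_less mod_add_self1 mod_less)
        moreover have "Suc v < 2 * r"
          using c False \<open>g = v\<close> by linarith
        ultimately show ?thesis
          using c False \<open>g = v\<close> by simp
      qed
      moreover have "(c + 2 * r - 1) mod (2 * r) < 2 * r"
        using r by simp
      ultimately show ?thesis
        using vtx_back[OF False] by metis
    next
      case odd: False
      then have "2 * r - 1 - c = Suc v mod (2 * r)"
        using c(2) by (simp only: g_def if_False)
      then show ?thesis
        using vtx_back[OF False c(1)] by blast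
    qed
    ultimately show ?thesis
      using c j by blast
  qed
qed

section \<open>Distinctness of the circuits at a fixed cell\<close>

lemma inj_on_two_blocks:
  assumes "inj_on p {..<r}" "inj_on q {..<r}" "\<And>i l. i < r \<Longrightarrow> l < r \<Longrightarrow> p i \<noteq> q l"
  shows "inj_on (\<lambda>k. if k < r then p k else q (k - r)) {..<2 * r :: nat}"
proof (rule inj_onI)
  fix k l :: nat
  assume "k \<in> {..<2 * r}" "l \<in> {..<2 * r}"
    and eq: "(if k < r then p k else q (k - r)) = (if l < r then p l else q (l - r))"
  then have kl: "k - r < r" "l - r < r"
    by auto
  consider "k < r" "l < r" | "k < r" "r \<le> l" | "r \<le> k" "l < r" | "r \<le> k" "r \<le> l"
    by linarith
  then show "k = l"
  proof cases
    case 1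
    then show ?thesis
      using eq inj_onD[OF assms(1), of k l] by simp
  next
    case 2
    then show ?thesis
      using eq kl assms(3)[of k "l - r"] by simp
  next
    case 3
    then show ?thesis
      using eq kl assms(3)[of l "k - r"] by simp
  next
    case 4
    then show ?thesis
      using eq kl inj_onD[OF assms(2), of "k - r" "l - r"] by auto
  qed
qed

definition large_vtx :: "nat \<Rightarrow> nat \<Rightarrow> nat \<Rightarrow> nat \<Rightarrow> nat" where
  "large_vtx r k j c = (if k < r then fwd_vtx r k j c else bwd_vtx r (k - r) j c)"

definition large_lab :: "nat \<Rightarrow> nat \<Rightarrow> nat \<Rightarrow> nat \<Rightarrow> nat \<Rightarrow> nat" where
  "large_lab r s k j c = (if k < r then fwd_lab s k j c else bwd_lab r s (k - r) j c)"

lemma even_fwd_vtx: "even (fwd_vtx r i j c) \<longleftrightarrow> even c"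
  by (simp add: fwd_vtx_def dvd_mod_iff)

lemma even_bwd_vtx:
  assumes "c < 2 * r"
  shows "even (bwd_vtx r i j c) \<longleftrightarrow> odd c"
  using assms by (auto simp: bwd_vtx_def dvd_mod_iff)

text \<open>Forward circuits stand on vertices of the parity of the column and backward ones on the
  opposite parity. Inside a family the shift by \<open>2 * i\<close> separates.\<close>

lemma large_vtx_inj:
  assumes "c < 2 * r"
  shows "inj_on (\<lambda>k. large_vtx r k j c) {..<2 * r}"
  unfolding large_vtx_def
proof (rule inj_on_two_blocks)
  have P: "inj_on (\<lambda>i. (u + 2 * i) mod (2 * r)) {..<r}" for u
    by (rule inj_on_shift_mod) (auto simp: inj_on_def)
  then show "inj_on (\<lambda>i. fwd_vtx r i j c) {..<r}"
    by (simp only: fwd_vtx_def)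
  show "inj_on (\<lambda>i. bwd_vtx r i j c) {..<r}"
  proof (cases "j = 0")
    case True
    then have "bwd_vtx r i j c = (c + 1 + 2 * i) mod (2 * r)" for i
      by (simp add: bwd_vtx_def)
    then show ?thesis
      using P by presburger
  next
    case False
    then have "bwd_vtx r i j c = (2 * r - 1 - c + 2 * r + 2 * i) mod (2 * r)" for i
      by (simp add: bwd_vtx_def add_ac)
    then show ?thesis
      using P by presburger
  qed
  show "fwd_vtx r i j c \<noteq> bwd_vtx r l j c" for i l
    using even_fwd_vtx[of r i j c] even_bwd_vtx[OF assms, of l j] by metis
qed

text \<open>Column 0 shifts modulo \<open>s - 1\<close>, so \<open>r\<close> circuits need
  \<open>r \<le> s - 1\<close>.\<close>

lemma fwd_lab_inj:
  assumes "r < s" "(j, c) \<noteq> (0, 0)"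
  shows "inj_on (\<lambda>i. fwd_lab s i j c) {..<r}"
proof -
  have P: "inj_on (\<lambda>i. (j + i) mod s) {..<r}" "inj_on (\<lambda>i. (j - 1 + i) mod (s - 1)) {..<r}"
    using assms(1) by (auto intro: inj_on_mod_add)
  consider "odd c" | "even c" "c \<noteq> 0" | "c = 0" "j \<noteq> 0"
    using assms by auto
  then show ?thesis
  proof cases
    case 1
    then show ?thesis
      using comp_inj_on[OF P(1) inj_on_add[of s]] by (simp add: fwd_lab_def comp_def)
  next
    case 2
    then show ?thesis
      using P(1) by (simp add: fwd_lab_def)
  next
    case 3
    then show ?thesis
      using comp_inj_on[OF P(2) inj_on_add[of 1]] by (simp add: fwd_lab_def comp_def)
  qed
qed

lemma bwd_gap_inj:
  assumes "r < s" "(j, g) \<noteq> (0, 0)"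
  shows "inj_on (\<lambda>i. bwd_gap s i j g) {..<r}"
proof -
  \<comment> \<open>By \<open>r < s\<close>, \<open>i \<le> s - 2\<close>, so
    \<open>s - 2 - i\<close> does not truncate and is injective in \<open>i\<close>.\<close>
  have P: "inj_on (\<lambda>i. (j + (i + 1)) mod s) {..<r}" "inj_on (\<lambda>i. (j + (s - 2 - i)) mod s) {..<r}"
    by (rule inj_on_shift_mod; use assms(1) in \<open>auto simp: inj_on_def\<close>)+
  have R: "(j + (s - 2 - i)) mod s < s" for i
    using assms by simp
  consider "j = 0" "g \<noteq> 0" | "j \<noteq> 0" "odd g" | "j \<noteq> 0" "even g"
    using assms by auto
  then show ?thesis
  proof cases
    case 1
    then show ?thesis
      using assms(1) by (auto simp: bwd_gap_def inj_on_def)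
  next
    case 2
    then show ?thesis
      using comp_inj_on[OF P(2) inj_on_add[of s]] by (simp add: bwd_gap_def comp_def)
  next
    case 3
    show ?thesis
    proof (rule inj_onI)
      fix i l assume il: "i \<in> {..<r}" "l \<in> {..<r}" and eq: "bwd_gap s i j g = bwd_gap s l j g"
      define x where "x = (j + (i + 1)) mod s"
      define y where "y = (j + (l + 1)) mod s"
      \<comment> \<open>The exceptional value is at least \<open>s\<close> and meets no plain value;
        if both sides are exceptional, then \<open>x\<close> and \<open>y\<close> are both
        0.\<close>
      have "bwd_gap s i j g = (if g = 0 \<and> x = 0 then s + (s - 2 - i) else x)"
        "bwd_gap s l j g = (if g = 0 \<and> y = 0 then s + (s - 2 - l) else y)"
        unfolding x_def y_def using 3 by (simp_all add: bwd_gap_def)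
      moreover have "x < s" "y < s"
        using assms(1) by (simp_all add: x_def y_def)
      ultimately have "x = y"
        using eq by (auto split: if_splits)
      then show "i = l"
        using inj_onD[OF P(1) _ il] by (simp only: x_def y_def)
    qed
  qed
qed

lemma fwd_lab_less:
  assumes "2 \<le> s"
  shows "fwd_lab s i j c < 2 * s"
proof -
  have "(if P then s + y else if Q then y else if R then 0 else 1 + z) < 2 * s"
    if "y < s" "z < s - 1" for P Q R y z
    using that by auto
  then show ?thesis
    unfolding fwd_lab_def using assms by simp
qed

lemma bwd_gap_less:
  assumes "i + 1 < s"
  shows "bwd_gap s i j g < 2 * s"
proof -
  have "(j + (i + 1)) mod s < s" "(j + (s - 2 - i)) mod s < s"
    using assms by simp_all
  then have "(j + (i + 1)) mod s < 2 * s" "s + (j + (s - 2 - i)) mod s < 2 * s"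
    by linarith+
  then show ?thesis
    unfolding bwd_gap_def using assms by auto
qed

lemma fwd_lab_less_iff:
  assumes "2 \<le> s"
  shows "fwd_lab s i j c < s \<longleftrightarrow> even c"
proof -
  have "(j - 1 + i) mod (s - 1) < s - 1" "(j + i) mod s < s"
    using assms by simp_all
  then have "1 + (j - 1 + i) mod (s - 1) < s" "(j + i) mod s < s"
    by linarith+
  then show ?thesis
    unfolding fwd_lab_def by auto
qed

text \<open>In row 0 by the exchange, and in later rows because column \<open>c\<close> crosses a
  gap of opposite parity, one label is below \<open>s\<close> and the other is not. The exception is
  the exchanged label on gap 0 of a later row.\<close>

lemma fwd_lab_neq_bwd_lab:
  assumes "r < s" "i < r" "l < r" "j < s" "c < 2 * r" "(j, c) \<noteq> (0, 0)"
  shows "fwd_lab s i j c \<noteq> bwd_lab r s l j c"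
proof (cases "j = 0")
  case True
  then show ?thesis
    using assms fwd_lab_less_iff[of s i j c] by (auto simp: bwd_lab_def bwd_gap_def)
next
  case False
  let ?g = "2 * r - 1 - c"
  have g: "even ?g \<longleftrightarrow> odd c"
    using assms by auto
  have less: "(j + (l + 1)) mod s < s"
    using assms by simp
  show ?thesis
  proof (cases "odd c \<and> ?g = 0 \<and> (j + (l + 1)) mod s = 0")
    case True
    have "fwd_lab s i j c \<noteq> s + (s - 2 - l)"
    proof
      assume "fwd_lab s i j c = s + (s - 2 - l)"
      then have "(j + i) mod s = s - 2 - l"
        using True by (simp add: fwd_lab_def)
      \<comment> \<open>Adding \<open>l + 2\<close> to both sides brings out
        \<open>j + (l + 1)\<close>, which vanishes modulo \<open>s\<close>. What remains is
        \<open>i + 1\<close>, strictly between 0 and \<open>s\<close>.\<close>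
      then have "(j + (l + 1) + (i + 1)) mod s = (s - 2 - l + (l + 2)) mod s"
        by (metis (no_types, lifting) ab_semigroup_add_class.add_ac(1) add.commute add.left_commute mod_add_left_eq one_add_one)
      also have "s - 2 - l + (l + 2) = s"
        using assms by linarith
      finally have "(i + 1) mod s = 0"
        using True by (metis add_0 mod_add_left_eq mod_self)
      then show False
        using assms by simp
    qed
    then show ?thesis
      using True False by (simp add: bwd_lab_def bwd_gap_def)
  next
    case other: False
    then have "bwd_lab r s l j c < s \<longleftrightarrow> odd c"
      using False g less by (auto simp: bwd_lab_def bwd_gap_def)
    then show ?thesis
      using fwd_lab_less_iff[of s i j c] assms by auto
  qed
qed

lemma large_lab_inj:
  assumes "r < s" "j < s" "c < 2 * r" "(j, c) \<noteq> (0, 0)"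
  shows "inj_on (\<lambda>k. large_lab r s k j c) {..<2 * r}"
  unfolding large_lab_def
proof (rule inj_on_two_blocks)
  show "inj_on (\<lambda>i. fwd_lab s i j c) {..<r}"
    using assms by (intro fwd_lab_inj) auto
  show "inj_on (\<lambda>i. bwd_lab r s i j c) {..<r}"
    unfolding bwd_lab_def using assms by (intro bwd_gap_inj) auto
  show "fwd_lab s i j c \<noteq> bwd_lab r s l j c" if "i < r" "l < r" for i l
    using fwd_lab_neq_bwd_lab assms that by blast
qed

lemma cyclic_grid_large:
  assumes "1 \<le> r" "r < s"
  shows "cyclic_grid s (2 * r) (2 * r) (large_vtx r) (large_lab r s) (\<lambda>k. large_vtx r k 0 (2 * r - 1))"
proof
  fix k j c assume k: "k < 2 * r" and j: "j < s" and c: "c < 2 * r"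
  show "large_vtx r k j c < 2 * r"
    using assms by (simp add: large_vtx_def fwd_vtx_def bwd_vtx_def)
  have "k - r + 1 < s" "2 \<le> s"
    using assms k by auto
  then show "large_lab r s k j c < 2 * s"
    by (simp add: large_lab_def bwd_lab_def fwd_lab_less bwd_gap_less)
next
  fix k j assume k: "k < 2 * r" and j: "j < s"
  \<comment> \<open>The left side is where the forward row 0 of a backward circuit ends, the right
    side where its backward rows end.\<close>
  have "2 * r - 1 + (2 * (k - r) + 1) = 2 * r + 2 * (k - r)"
    using assms by simp
  then show "large_vtx r k j (2 * r - 1) = large_vtx r k 0 (2 * r - 1)"
    by (simp add: large_vtx_def fwd_vtx_def bwd_vtx_def)
next
  fix k a b assume "k < 2 * r" "a < 2 * r" "b < 2 * s"
  then show "\<exists>j<s. \<exists>c<2 * r. b = large_lab r s k j c \<and>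
      (a = large_vtx r k j c \<or> a = large_vtx r k j ((c + 2 * r - 1) mod (2 * r)))"
    using assms cover_fwd[of r s a b k] cover_bwd[of r "k - r" s a b]
    by (cases "k < r") (simp_all add: large_vtx_def large_lab_def)
qed (use assms in auto)

lemma exists_mutually_avoiding_large_side:
  assumes fin: "finite A" "finite B" and disj: "A \<inter> B = {}" and card: "card A = 2 * r" "card B = 2 * s"
    and rs: "1 \<le> r" "r < s" and x: "x \<in> B"
  shows "\<exists>C. mutually_avoiding (B \<union> A) (biclique B A) x C \<and> card C = 2 * r"
proof -
  obtain \<psi> where \<psi>: "bij_betw \<psi> {..<2 * s} B" "\<psi> 0 = x"
    using ex_bij_betw_lessThan[OF fin(2) x] unfolding card by blast
  obtain \<phi> where \<phi>: "bij_betw \<phi> {..<2 * r} A"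
    using ex_bij_betw_nat_finite[OF fin(1)] unfolding card atLeast0LessThan by blast
  interpret cyclic_grid s "2 * r" "2 * r" "large_vtx r" "large_lab r s" "\<lambda>k. large_vtx r k 0 (2 * r - 1)"
    using rs by (rule cyclic_grid_large)
  have "large_lab r s k 0 0 = 0" for k
    by (simp add: large_lab_def fwd_lab_def bwd_lab_def bwd_gap_def)
  then show ?thesis
    using mutually_avoiding_from_label[OF \<phi> \<psi>(1) disj] large_vtx_inj large_lab_inj rs \<psi>(2) by blast
qed

section \<open>Upper bounds\<close>

lemma eulerian_circuit_biclique_side:
  assumes p: "eulerian_circuit (A \<union> B) (biclique A B) x p"
    and disj: "A \<inter> B = {}" and x: "x \<in> A" and k: "k \<le> card (biclique A B)"
  shows "p ! k \<in> (if even k then A else B)"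
  using k
proof (induction k)
  case 0
  have "p ! 0 = x"
    using p by (simp add: eulerian_circuit_def trail_def flip: hd_conv_nth)
  then show ?case
    using x by simp
next
  case (Suc k)
  have "adjacent (biclique A B) (p ! k) (p ! Suc k)"
    using p Suc.prems length_eulerian_circuit[OF p]
    by (simp add: eulerian_circuit_def trail_def successively_conv_nth)
  then show ?case
    using Suc disj by (auto simp: adjacent_biclique_iff[OF disj] split: if_splits)
qed

text \<open>Avoiding circuits differ at every interior position, so evaluation at position
  \<open>k\<close> is injective on \<open>C\<close>.\<close>

lemma card_mutually_avoiding_le:
  assumes C: "mutually_avoiding V E x C" and k: "1 \<le> k" "k < card E"
    and S: "finite S" "\<And>p. eulerian_circuit V E x p \<Longrightarrow> p ! k \<in> S"
  shows "card C \<le> card S"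
proof (rule card_inj_on_le[where f = "\<lambda>p. p ! k"])
  show "inj_on (\<lambda>p. p ! k) C"
  proof (rule inj_onI, rule ccontr)
    fix p q assume "p \<in> C" "q \<in> C" "p ! k = q ! k" "p \<noteq> q"
    moreover from this have "avoiding E p q"
      using C by (auto simp: mutually_avoiding_def dest: pairwiseD)
    ultimately show False
      using k by (auto simp: avoiding_def)
  qed
  show "(\<lambda>p. p ! k) ` C \<subseteq> S"
    using C S by (auto simp: mutually_avoiding_def)
qed (fact S)

lemma eulerian_circuit_nth_2:
  assumes p: "eulerian_circuit V E x p" and E: "2 \<le> card E"
  shows "p ! 2 \<noteq> x"
proof
  assume eq: "p ! 2 = x"
  have len: "3 \<le> length p"
    using length_eulerian_circuit[OF p] E by simp
  have "p ! 0 = x" "distinct (walk_edges p)"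
    using p by (auto simp: eulerian_circuit_def trail_def simp flip: hd_conv_nth)
  moreover have "walk_edges p ! 0 = {p ! 0, p ! 1}" "walk_edges p ! 1 = {p ! 1, p ! 2}"
    using len by (simp_all add: nth_walk_edges numeral_2_eq_2)
  moreover have "0 < length (walk_edges p)" "1 < length (walk_edges p)"
    using len by auto
  ultimately show False
    using eq nth_eq_iff_index_eq[of "walk_edges p" 0 1] by (simp add: insert_commute)
qed

section \<open>Exact values and the two indices\<close>

lemma av_eqI:
  assumes "simple_graph V E" "\<exists>C. mutually_avoiding V E x C \<and> card C = k"
    and "\<And>C. mutually_avoiding V E x C \<Longrightarrow> card C \<le> k"
  shows "av V E x = k"
  unfolding av_def using assms by (intro Max_eqI av_set) auto

theorem theorem11:
  fixes r s :: nat and V :: "'a set" and E :: "'a set set"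
  assumes "1 \<le> r" and "r < s"
    and "complete_bipartite (2 * r) (2 * s) V E"
  shows "av_index V E = 2 * r - 1 \<and>
         mean_av_index V E = 2 * real r - real r / (real r + real s)"
proof -
  have graph: "simple_graph V E"
    using assms(3) by (rule complete_bipartite_simple_graph)
  obtain A B where fin: "finite A" "finite B" and disj: "A \<inter> B = {}"
    and card: "card A = 2 * r" "card B = 2 * s" and V: "V = A \<union> B" and E: "E = biclique A B"
    using assms(3) unfolding complete_bipartite_def biclique_def by blast
  have "card E = 4 * (r * s)"
    using card_biclique[OF fin disj] by (simp add: E card)
  moreover have "1 \<le> r * s"
    using assms by simp
  \<comment> \<open>This makes the positions 1 and 2 interior.\<close>
  ultimately have cE: "4 \<le> card E"
    by linarith
  \<comment> \<open>Circuits start on the side named first, so the sides are swapped for a start in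
    \<open>B\<close>.\<close>
  have VE: "V = B \<union> A" "E = biclique B A"
    using V E by (auto simp: biclique_commute)
  have avA: "av V E x = 2 * r - 1" if x: "x \<in> A" for x
  proof (rule av_eqI[OF graph])
    show "\<exists>C. mutually_avoiding V E x C \<and> card C = 2 * r - 1"
      unfolding V E using assms
      by (intro exists_mutually_avoiding_small_side[OF fin disj card _ _ _ x]) auto
    show "card C \<le> 2 * r - 1" if "mutually_avoiding V E x C" for C
    proof -
      have "p ! 2 \<in> A - {x}" if p: "eulerian_circuit V E x p" for p
        using eulerian_circuit_biclique_side[OF p[unfolded V E] disj x, of 2]
          eulerian_circuit_nth_2[OF p] cE E by simp
      then have "card C \<le> card (A - {x})"
        using that cE fin by (intro card_mutually_avoiding_le[where k = 2]) auto
      then show ?thesis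
        using x fin card by simp
    qed
  qed
  have avB: "av V E x = 2 * r" if x: "x \<in> B" for x
  proof (rule av_eqI[OF graph])
    show "\<exists>C. mutually_avoiding V E x C \<and> card C = 2 * r"
      unfolding VE using assms
      by (intro exists_mutually_avoiding_large_side[OF fin disj card _ _ x]) auto
    show "card C \<le> 2 * r" if "mutually_avoiding V E x C" for C
    proof -
      have "p ! 1 \<in> A" if p: "eulerian_circuit V E x p" for p
        using eulerian_circuit_biclique_side[OF p[unfolded VE] _ x, of 1] disj cE VE
        by (simp add: Int_commute)
      then have "card C \<le> card A"
        using that cE fin by (intro card_mutually_avoiding_le[where k = 1]) auto
      then show ?thesis
        using card by simp
    qed
  qed
  have ne: "A \<noteq> {}" "B \<noteq> {}"
    using card assms by auto
  have "av V E ` V = {2 * r - 1, 2 * r}"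
    using ne avA avB unfolding V by (auto simp: image_Un)
  then have "av_index V E = 2 * r - 1"
    by (simp add: av_index_def)
  moreover have "mean_av_index V E = 2 * real r - real r / (real r + real s)"
  proof -
    have "(\<Sum>v\<in>V. real (av V E v)) = (\<Sum>v\<in>A. 2 * real r - 1) + (\<Sum>v\<in>B. 2 * real r)"
      unfolding V using fin disj avA avB assms(1) by (simp add: sum.union_disjoint V)
    also have "\<dots> = 2 * real r * (2 * real r - 1) + 2 * real s * (2 * real r)"
      using card by simp
    finally have "mean_av_index V E =
        (2 * real r * (2 * real r - 1) + 2 * real s * (2 * real r)) / (2 * real r + 2 * real s)"
      using fin disj card by (simp add: mean_av_index_def V card_Un_disjoint)
    also have "\<dots> = 2 * real r - real r / (real r + real s)"
      using assms by (simp add: field_simps)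
    finally show ?thesis .
  qed
  ultimately show ?thesis
    by blast
qed

end
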